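(* Let $(E,\mathcal{C},r_{\mathcal{C}})$ be a semimatroid and $\bm x=\{x_e\}_{e\in E}$, $\bm y=\{y_e\}_{e\in E}$ indeterminates. Then \[ Z(\mathcal{C};\lambda\xi,\bm x\bm y)=\sum_{T\in\mathcal{C}}\xi^{-r_\mathcal{C}(T)}(-\bm y)^TZ(\mathcal{C}|T;\lambda,-\bm x)Z(\mathcal{C}/T;\xi,\bm y). \] In particular, \[ Z(\mathcal{C};\lambda,\bm y)=\sum_{T\in\mathcal{C}}(-\bm y)^TZ(\mathcal{C}|T;\lambda,-1)Z(\mathcal{C}/T;1,\bm y). \]
   Context: A semimatroid is a triple $(E,\mathcal{C},r_{\mathcal{C}})$ where $E$ is a finite set, $\mathcal{C}$ is a nonempty simplicial complex on $E$, and $r_{\mathcal{C}}:\mathcal{C}\to\mathbb{N}$ satisfies: (SR1) $0\le r_{\mathcal{C}}(X)\le |X|$; (SR2) $X\subseteq Y$ in $\mathcal{C}$ implies $r_{\mathcal{C}}(X)\le r_{\mathcal{C}}(Y)$; (SR3) if $X,Y,X\cup Y\in\mathcal{C}$ then $r_{\mathcal{C}}(X\cap Y)+r_{\mathcal{C}}(X\cup Y)\le r_{\mathcal{C}}(X)+r_{\mathcal{C}}(Y)$; (SR4) if $X,Y\in\mathcal{C}$ and $r_{\mathcal{C}}(X)=r_{\mathcal{C}}(X\cap Y)$ then $X\cup Y\in\mathcal{C}$; (SR5) if $X,Y\in\mathcal{C}$ and $r_{\mathcal{C}}(X)<r_{\mathcal{C}}(Y)$ then $X\cup\{e\}\in\mathcal{C}$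 for some $e\in Y-X$. For $T\in\mathcal{C}$: the restriction $\mathcal{C}|T$ is the semimatroid on $T$ with central sets $\{Y\subseteq T: Y\in\mathcal{C}\}$ and rank $r_{\mathcal{C}}$ restricted; the contraction $\mathcal{C}/T$ is the semimatroid on $E-T$ with central sets $\{Y\subseteq E-T: Y\cup T\in\mathcal{C}\}$ and rank $r_{\mathcal{C}/T}(Y)=r_{\mathcal{C}}(Y\cup T)-r_{\mathcal{C}}(T)$. For a semimatroid $\mathcal{D}$ on ground set $S$ and a family $\bm z=\{z_e\}$ indexed by (a superset of) $S$, $Z(\mathcal{D};\lambda,\bm z)=\sum_{A\in\mathcal{D}}\lambda^{-r_{\mathcal{D}}(A)}\bm z^A$, with $\bm z^A=\prod_{e\in A}z_e$ (only the variables indexed by $S$ are used). Notation: $(\bm x\bm y)^A=\prod_{e\in A}x_ey_e$, $(-\bm y)^A=\prod_{e\in A}(-y_e)$, $-\bm x=\{-x_e\}$, and the argument $-1$ (resp. $1$) means all variables are set to $-1$ (resp. $1$). *)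

theory Defs
  imports Main
begin

record 'e semimatroid_data =
  ground  :: "'e set"
  central :: "'e set set"
  rk      :: "'e set \<Rightarrow> nat"

text \<open>
  The values of \<open>rk\<close> outside \<open>central\<close> are irrelevant. As usual for semimatroids, the simplicial
  complex is not required to contain all singletons of the ground set.
\<close>

locale semimatroid =
  fixes M :: "'e semimatroid_data"
  assumes finite_ground: "finite (ground M)"
    and central_ground: "X \<in> central M \<Longrightarrow> X \<subseteq> ground M"
    and central_nonempty: "central M \<noteq> {}"
    and central_down: "\<lbrakk>Y \<in> central M; X \<subseteq> Y\<rbrakk> \<Longrightarrow> X \<in> central M"
    and SR1: "X \<in> central M \<Longrightarrow> rk M X \<le> card X"
    and SR2: "\<lbrakk>X \<in> central M; Y \<in> central M; X \<subseteq> Y\<rbrakk> \<Longrightarrow> rk M X \<le> rk M Y"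
    and SR3: "\<lbrakk>X \<in> central M; Y \<in> central M; X \<union> Y \<in> central M\<rbrakk>
               \<Longrightarrow> rk M (X \<inter> Y) + rk M (X \<union> Y) \<le> rk M X + rk M Y"
    and SR4: "\<lbrakk>X \<in> central M; Y \<in> central M; rk M X = rk M (X \<inter> Y)\<rbrakk> \<Longrightarrow> X \<union> Y \<in> central M"
    and SR5: "\<lbrakk>X \<in> central M; Y \<in> central M; rk M X < rk M Y\<rbrakk>
               \<Longrightarrow> \<exists>e\<in>Y - X. X \<union> {e} \<in> central M"

definition restriction :: "'e semimatroid_data \<Rightarrow> 'e set \<Rightarrow> 'e semimatroid_data" where
  "restriction M T = \<lparr>ground = T, central = {Y. Y \<subseteq> T \<and> Y \<in> central M}, rk = rk M\<rparr>"

text \<open>By SR2, the truncated subtraction below is exact on central sets when \<open>T\<close> is central.\<close>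

definition contraction :: "'e semimatroid_data \<Rightarrow> 'e set \<Rightarrow> 'e semimatroid_data" where
  "contraction M T =
     \<lparr>ground = ground M - T,
      central = {Y. Y \<subseteq> ground M - T \<and> Y \<union> T \<in> central M},
      rk = (\<lambda>Y. rk M (Y \<union> T) - rk M T)\<rparr>"

text \<open>
  Indeterminates are rendered by arbitrary elements of an arbitrary field (with \<open>l\<close> nonzero, since
  negative powers of it occur). Taking a field of rational functions and its generators gives the
  identities between formal expressions.
\<close>

definition Z :: "'e semimatroid_data \<Rightarrow> 'k::field \<Rightarrow> ('e \<Rightarrow> 'k) \<Rightarrow> 'k" where
  "Z M l z = (\<Sum>A\<in>central M. l powi (- int (rk M A)) * (\<Prod>e\<in>A. z e))"

lemma (in semimatroid) semimatroid_restriction: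
  assumes "T \<in> central M"
  shows "semimatroid (restriction M T)"
proof -
  have T: "finite T" "T \<subseteq> ground M"
    using assms central_ground finite_ground finite_subset by blast+
  have sub: "Y \<in> central M" if "Y \<subseteq> T" for Y
    using that assms central_down by blast
  have central: "central (restriction M T) = Pow T"
    using sub by (auto simp: restriction_def)
  have rk: "rk (restriction M T) = rk M" and ground: "ground (restriction M T) = T"
    by (simp_all add: restriction_def)
  show ?thesis
    unfolding semimatroid_def central rk ground
  proof (intro conjI allI impI)
    show "\<exists>e\<in>Y - X. X \<union> {e} \<in> Pow T"
      if "X \<in> Pow T" "Y \<in> Pow T" "rk M X < rk M Y" for X Y
      using that SR5[of X Y] sub by fastforce
  qed (use T sub SR1 SR2 SR3 in auto)
qed

lemma (in semimatroid) semimatroid_contraction: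
  assumes T: "T \<in> central M"
  shows "semimatroid (contraction M T)"
proof -
  define C' where "C' = central (contraction M T)"
  have C': "Y \<in> C' \<longleftrightarrow> Y \<subseteq> ground M - T \<and> Y \<union> T \<in> central M" for Y
    by (simp add: C'_def contraction_def)
  have rk': "rk (contraction M T) Y = rk M (Y \<union> T) - rk M T" for Y
    by (simp add: contraction_def)
  have ge: "rk M T \<le> rk M (Y \<union> T)" if "Y \<in> C'" for Y
    using that SR2 T by (auto simp: C')
  have down: "X \<in> C'" if "Y \<in> C'" "X \<subseteq> Y" for X Y
    using that central_down[of "Y \<union> T" "X \<union> T"] by (auto simp: C')
  have distrib: "(X \<inter> Y) \<union> T = (X \<union> T) \<inter> (Y \<union> T)" "(X \<union> Y) \<union> T = (X \<union> T) \<union> (Y \<union> T)" for X Y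
    by auto
  show ?thesis
    unfolding semimatroid_def C'_def[symmetric] rk'
  proof (intro conjI allI impI)
    show "finite (ground (contraction M T))"
      using finite_ground by (simp add: contraction_def)
    show "X \<subseteq> ground (contraction M T)" if "X \<in> C'" for X
      using that by (simp add: C' contraction_def)
    have "{} \<in> C'" using T by (simp add: C')
    then show "C' \<noteq> {}" by blast
    show "X \<in> C'" if "Y \<in> C'" "X \<subseteq> Y" for X Y using down that .
    show "rk M (X \<union> T) - rk M T \<le> card X" if X: "X \<in> C'" for X
    proof -
      have "X \<in> central M" using X central_down[of "X \<union> T" X] by (auto simp: C')
      moreover have "X \<union> T \<in> central M" using X by (simp add: C')
      ultimately show ?thesis using SR3[of X T] SR1[of X] T by simp
    qed
    show "rk M (X \<union> T) - rk M T \<le> rk M (Y \<union> T) - rk M T"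
      if "X \<in> C'" "Y \<in> C'" "X \<subseteq> Y" for X Y
      using that SR2[of "X \<union> T" "Y \<union> T"] by (intro diff_le_mono) (auto simp: C')
    show "rk M (X \<inter> Y \<union> T) - rk M T + (rk M (X \<union> Y \<union> T) - rk M T)
            \<le> rk M (X \<union> T) - rk M T + (rk M (Y \<union> T) - rk M T)"
      if "X \<in> C'" "Y \<in> C'" "X \<union> Y \<in> C'" for X Y
      using that SR3[of "X \<union> T" "Y \<union> T"] ge[of X] ge[of Y] ge[of "X \<union> Y"] ge[of "X \<inter> Y"]
        down[of X "X \<inter> Y"]
      by (simp add: C' distrib)
    show "X \<union> Y \<in> C'"
      if "X \<in> C'" "Y \<in> C'" "rk M (X \<union> T) - rk M T = rk M (X \<inter> Y \<union> T) - rk M T" for X Y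
      using that SR4[of "X \<union> T" "Y \<union> T"] ge[of X] ge[of "X \<inter> Y"] down[of X "X \<inter> Y"]
      by (simp add: C' distrib)
    show "\<exists>e\<in>Y - X. X \<union> {e} \<in> C'"
      if XY: "X \<in> C'" "Y \<in> C'" "rk M (X \<union> T) - rk M T < rk M (Y \<union> T) - rk M T" for X Y
    proof -
      have "rk M (X \<union> T) < rk M (Y \<union> T)" using XY(3) by linarith
      then obtain e where "e \<in> (Y \<union> T) - (X \<union> T)" "X \<union> T \<union> {e} \<in> central M"
        using SR5[of "X \<union> T" "Y \<union> T"] XY(1,2) C' by blast
      then show ?thesis using XY central_ground[of "Y \<union> T"] by (intro bexI[of _ e]) (auto simp: C')
    qed
  qed
qed

end

theory Submission
  imports Defs
begin

text \<open>
  Expanding all three polynomials on the right-hand side gives a sum over chains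
  \<open>A \<subseteq> T \<subseteq> B\<close> of central sets, in which \<open>T\<close> occurs only through the factor
  \<open>(-y)\<^sup>T y\<^sup>B\<^sup>-\<^sup>T\<close>. Summed over \<open>T\<close> this factors as \<open>(-y)\<^sup>A\<close> times the product of
  \<open>-y\<^sub>e + y\<^sub>e\<close> over \<open>B - A\<close>, so only the terms with \<open>A = B\<close> survive.
\<close>

lemma sum_interval_prod_minus:
  fixes y :: "'e \<Rightarrow> 'k::comm_ring_1"
  assumes "finite B"
  shows "(\<Sum>T | A \<subseteq> T \<and> T \<subseteq> B. (\<Prod>e\<in>T. - y e) * (\<Prod>e\<in>B - T. y e))
           = (if A = B then \<Prod>e\<in>B. - y e else 0)"
proof (cases "A \<subseteq> B")
  case True
  then have finA: "finite A"
    using assms finite_subset by blast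
  \<comment> \<open>Writing \<open>T = A \<union> X\<close> with \<open>X \<subseteq> B - A\<close>
    turns the interval into a power set and splits off the constant factor over
    \<open>A\<close>.\<close>
  have "(\<Sum>T | A \<subseteq> T \<and> T \<subseteq> B. (\<Prod>e\<in>T. - y e) * (\<Prod>e\<in>B - T. y e))
      = (\<Sum>X\<in>Pow (B - A). (\<Prod>e\<in>A \<union> X. - y e) * (\<Prod>e\<in>B - A - X. y e))"
    by (rule sum.reindex_bij_witness[of _ "\<lambda>X. A \<union> X" "\<lambda>T. T - A"])
       (use True in \<open>auto simp: Un_absorb1 intro!: arg_cong2[of _ _ _ _ "(*)"] prod.cong\<close>)
  also have "\<dots> = (\<Sum>X\<in>Pow (B - A).
      (\<Prod>e\<in>A. - y e) * ((\<Prod>e\<in>X. - y e) * (\<Prod>e\<in>B - A - X. y e)))"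
  proof (rule sum.cong[OF refl])
    fix X assume "X \<in> Pow (B - A)"
    then have "finite X" "A \<inter> X = {}"
      using assms finite_subset[of X B] by auto
    then show "(\<Prod>e\<in>A \<union> X. - y e) * (\<Prod>e\<in>B - A - X. y e)
        = (\<Prod>e\<in>A. - y e) * ((\<Prod>e\<in>X. - y e) * (\<Prod>e\<in>B - A - X. y e))"
      using finA by (simp add: prod.union_disjoint mult.assoc)
  qed
  \<comment> \<open>By \<open>prod_add\<close>, the sum over all \<open>X\<close> is the expansion
    of a product of the binomials \<open>- y e + y e\<close>.\<close>
  also have "\<dots> = (\<Prod>e\<in>A. - y e) * (\<Prod>e\<in>B - A. - y e + y e)"
    using assms by (subst prod_add) (simp_all add: sum_distrib_left)
  \<comment> \<open>Every binomial is zero, so the product is \<open>0 ^ card (B - A)\<close>. It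
    equals 1 exactly when \<open>B - A\<close> is empty, which under \<open>A \<subseteq> B\<close>
    means \<open>A = B\<close>.\<close>
  also have "\<dots> = (if A = B then \<Prod>e\<in>B. - y e else 0)"
    using True assms by (auto simp: power_0_left card_eq_0_iff)
  finally show ?thesis .
next
  case False
  then have none: "{T. A \<subseteq> T \<and> T \<subseteq> B} = {}"
    by blast
  from False show ?thesis
    unfolding none by auto
qed

context semimatroid
begin

lemma finite_central: "finite (central M)"
  by (rule finite_subset[of _ "Pow (ground M)"]) (use central_ground finite_ground in auto)

lemma Z_restriction:
  "Z (restriction M T) l z =
     (\<Sum>A | A \<in> central M \<and> A \<subseteq> T. l powi (- int (rk M A)) * (\<Prod>e\<in>A. z e))"
  unfolding Z_def restriction_def by (intro sum.cong) auto

text \<open>The prefactor cancels the shift by \<open>rk M T\<close> in the rank of the contraction.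
  Each term then carries the rank of \<open>B = Y \<union> T\<close> in \<open>M\<close> itself, so
  its power of \<open>l\<close> no longer depends on \<open>T\<close>.\<close>

lemma Z_contraction:
  fixes l :: "'k::field"
  assumes T: "T \<in> central M" and l: "l \<noteq> 0"
  shows "l powi (- int (rk M T)) * Z (contraction M T) l z =
     (\<Sum>B | B \<in> central M \<and> T \<subseteq> B. l powi (- int (rk M B)) * (\<Prod>e\<in>B - T. z e))"
proof -
  have "l powi (- int (rk M T)) * Z (contraction M T) l z =
      (\<Sum>Y | Y \<subseteq> ground M - T \<and> Y \<union> T \<in> central M.
         l powi (- int (rk M T)) *
         (l powi (- int (rk M (Y \<union> T) - rk M T)) * (\<Prod>e\<in>Y. z e)))"
    by (simp add: Z_def contraction_def sum_distrib_left)
  also have "\<dots> =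
      (\<Sum>Y | Y \<subseteq> ground M - T \<and> Y \<union> T \<in> central M.
         l powi (- int (rk M (Y \<union> T))) * (\<Prod>e\<in>Y. z e))"
  proof (rule sum.cong[OF refl])
    fix Y assume "Y \<in> {Y. Y \<subseteq> ground M - T \<and> Y \<union> T \<in> central M}"
    \<comment> \<open>This monotonicity makes the truncated subtraction of natural numbers exact, so
      that the exponents add up as integers.\<close>
    then have "rk M T \<le> rk M (Y \<union> T)"
      using T by (intro SR2) auto
    then have "- int (rk M (Y \<union> T)) = - int (rk M T) + - int (rk M (Y \<union> T) - rk M T)"
      by (simp add: of_nat_diff)
    then have "l powi (- int (rk M (Y \<union> T))) =
        l powi (- int (rk M T)) * l powi (- int (rk M (Y \<union> T) - rk M T))"
      using l by (metis power_int_add)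
    then show "l powi (- int (rk M T)) *
          (l powi (- int (rk M (Y \<union> T) - rk M T)) * (\<Prod>e\<in>Y. z e))
        = l powi (- int (rk M (Y \<union> T))) * (\<Prod>e\<in>Y. z e)"
      by (simp add: mult.assoc)
  qed
  also have "\<dots> =
      (\<Sum>B | B \<in> central M \<and> T \<subseteq> B. l powi (- int (rk M B)) * (\<Prod>e\<in>B - T. z e))"
  proof (rule sum.reindex_bij_witness[of _ "\<lambda>B. B - T" "\<lambda>Y. Y \<union> T"])
    fix Y assume "Y \<in> {Y. Y \<subseteq> ground M - T \<and> Y \<union> T \<in> central M}"
    then have "Y \<union> T - T = Y" by blast
    then show "Y \<union> T - T = Y"
      and "l powi (- int (rk M (Y \<union> T))) * (\<Prod>e\<in>Y \<union> T - T. z e) =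
        l powi (- int (rk M (Y \<union> T))) * (\<Prod>e\<in>Y. z e)"
      by simp_all
  qed (use central_ground in \<open>auto simp: Un_absorb2\<close>)
  finally show ?thesis .
qed

lemma Z_mult_convolution:
  fixes lam xi :: "'k::field"
  assumes xi: "xi \<noteq> 0"
  shows "Z M (lam * xi) (\<lambda>e. x e * y e) =
           (\<Sum>T\<in>central M. xi powi (- int (rk M T)) * (\<Prod>e\<in>T. - y e) *
              Z (restriction M T) lam (\<lambda>e. - x e) * Z (contraction M T) xi y)"
proof -
  define C where "C = central M"
  have finC: "finite C"
    by (simp add: C_def finite_central)
  \<comment> \<open>The weights are separated by their dependence on the chain: \<open>a\<close>
    sees only \<open>A\<close>, \<open>b\<close> sees only \<open>B\<close>, and \<open>w\<close>
    collects all factors that involve \<open>T\<close>.\<close>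
  define a where "a A = lam powi (- int (rk M A)) * (\<Prod>e\<in>A. - x e)" for A
  define b where "b B = xi powi (- int (rk M B))" for B
  define w where "w T B = (\<Prod>e\<in>T. - y e) * (\<Prod>e\<in>B - T. y e)" for T B
  have "(\<Sum>T\<in>C. xi powi (- int (rk M T)) * (\<Prod>e\<in>T. - y e) *
              Z (restriction M T) lam (\<lambda>e. - x e) * Z (contraction M T) xi y)
      = (\<Sum>T\<in>C. (\<Prod>e\<in>T. - y e) * Z (restriction M T) lam (\<lambda>e. - x e) *
            (xi powi (- int (rk M T)) * Z (contraction M T) xi y))"
    by (simp add: mult_ac)
  also have "\<dots> = (\<Sum>T\<in>C. (\<Prod>e\<in>T. - y e) * (\<Sum>A | A \<in> C \<and> A \<subseteq> T. a A) *
            (\<Sum>B | B \<in> C \<and> T \<subseteq> B. b B * (\<Prod>e\<in>B - T. y e)))"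
    by (rule sum.cong) (simp_all add: Z_restriction Z_contraction xi C_def a_def b_def)
  also have "\<dots> = (\<Sum>T\<in>C. \<Sum>A | A \<in> C \<and> A \<subseteq> T. \<Sum>B | B \<in> C \<and> T \<subseteq> B. a A * b B * w T B)"
    by (simp add: sum_distrib_left sum_distrib_right w_def mult_ac)
  \<comment> \<open>Two exchanges, first of \<open>T\<close> with \<open>A\<close> and then of
    \<open>T\<close> with \<open>B\<close>, make the sum over \<open>T\<close> the innermost
    one.\<close>
  also have "\<dots> = (\<Sum>A\<in>C. \<Sum>T | T \<in> C \<and> A \<subseteq> T. \<Sum>B | B \<in> C \<and> T \<subseteq> B. a A * b B * w T B)"
    by (rule sum.swap_restrict[OF finC finC])
  also have "\<dots> = (\<Sum>A\<in>C. \<Sum>B\<in>C. \<Sum>T | T \<in> {T \<in> C. A \<subseteq> T} \<and> T \<subseteq> B. a A * b B * w T B)"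
    by (intro sum.cong refl sum.swap_restrict) (simp_all add: finC)
  \<comment> \<open>The condition \<open>T \<in> C\<close> follows from
    \<open>T \<subseteq> B\<close> because \<open>C\<close> is closed under subsets. The inner sum
    therefore runs over the whole interval from \<open>A\<close> to \<open>B\<close>.\<close>
  also have "\<dots> = (\<Sum>A\<in>C. \<Sum>B\<in>C. a A * b B * (\<Sum>T | A \<subseteq> T \<and> T \<subseteq> B. w T B))"
    unfolding sum_distrib_left
    by (intro sum.cong refl) (use central_down in \<open>auto simp: C_def\<close>)
  also have "\<dots> = (\<Sum>A\<in>C. \<Sum>B\<in>C. if A = B then a A * b B * (\<Prod>e\<in>B. - y e) else 0)"
  proof (intro sum.cong refl)
    fix A B assume "B \<in> C"
    then have "finite B"
      using central_ground finite_ground finite_subset unfolding C_def by blast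
    then show "a A * b B * (\<Sum>T | A \<subseteq> T \<and> T \<subseteq> B. w T B) =
        (if A = B then a A * b B * (\<Prod>e\<in>B. - y e) else 0)"
      by (simp add: w_def sum_interval_prod_minus)
  qed
  also have "\<dots> = (\<Sum>A\<in>C. a A * b A * (\<Prod>e\<in>A. - y e))"
    by (simp add: finC)
  \<comment> \<open>On the diagonal both powers have exponent \<open>- int (rk M A)\<close> and
    merge. The two signs at each element cancel in the next step.\<close>
  also have "\<dots> = (\<Sum>A\<in>C. (lam * xi) powi (- int (rk M A)) * (\<Prod>e\<in>A. (- x e) * (- y e)))"
    unfolding a_def b_def prod.distrib power_int_mult_distrib by (simp only: mult_ac)
  also have "\<dots> = Z M (lam * xi) (\<lambda>e. x e * y e)"
    by (simp add: Z_def C_def)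
  finally show ?thesis
    by (simp add: C_def)
qed

end

theorem theorem2p6:
  fixes M :: "'e semimatroid_data"
    and lam xi :: "'k::field"
    and x y :: "'e \<Rightarrow> 'k"
  assumes "semimatroid M" and "lam \<noteq> 0" and "xi \<noteq> 0"
  shows "Z M (lam * xi) (\<lambda>e. x e * y e) =
           (\<Sum>T\<in>central M. xi powi (- int (rk M T)) * (\<Prod>e\<in>T. - y e) *
              Z (restriction M T) lam (\<lambda>e. - x e) * Z (contraction M T) xi y)
         \<and>
         Z M lam y =
           (\<Sum>T\<in>central M. (\<Prod>e\<in>T. - y e) *
              Z (restriction M T) lam (\<lambda>e. - 1) * Z (contraction M T) 1 y)"
proof -
  interpret semimatroid M by fact
  show ?thesis
    \<comment> \<open>The second identity is the case \<open>xi = 1\<close> with all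
      \<open>x e = 1\<close>, where every power of \<open>xi\<close> is 1.\<close>
    using Z_mult_convolution[of xi lam x y] Z_mult_convolution[of 1 lam "\<lambda>_. 1" y] assms(3)
    by simp
qed

end
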